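(* Let $Y$ be a random variable whose moment generating function $E[e^{tY}]$ exists for $|t|<r$, for some $r>0$. Define $T^{Y}(n,k)$ by $\frac{1}{k!}\big(E[e^{\frac{Y}{2}t}]-E[e^{-\frac{Y}{2}t}]\big)^{k}=\sum_{n=k}^{\infty}T^{Y}(n,k)\frac{t^{n}}{n!}$ $(k\ge0)$, and $B_{n}^{(c,Y)}(x)=\sum_{k=0}^{n}T^{Y}(n,k)x^{k}$. Then for all $n\ge k\ge 0$, $$\sum_{j=0}^{n-k}\binom{n}{k}k^{j}x^{j}T^{Y}(n-k,j)= B_{n,k}\Big(B_{0}^{(c,Y)}(x),2B_{1}^{(c,Y)}(x),3B_{2}^{(c,Y)}(x),\dots,(n-k+1)B_{n-k}^{(c,Y)}(x)\Big).$$
   Context: The partial Bell polynomials $B_{n,k}$ are defined by $\frac{1}{k!}\big(\sum_{m=1}^{\infty}x_{m}\frac{t^{m}}{m!}\big)^{k}=\sum_{n=k}^{\infty}B_{n,k}(x_{1},\dots,x_{n-k+1})\frac{t^{n}}{n!}$. Convention $0^0=1$. *)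

theory Defs
  imports "HOL-Probability.Probability" "HOL-Computational_Algebra.Formal_Power_Series"
begin

unbundle no vec_syntax
unbundle fps_syntax

section \<open>Partial Bell polynomials\<close>

text \<open>
  The value of \<open>B\<^sub>n\<^sub>,\<^sub>k(x\<^sub>1, \<dots>, x\<^sub>n\<^sub>-\<^sub>k\<^sub>+\<^sub>1)\<close> is read off as the coefficient of \<open>t\<^sup>n / n!\<close> in
  \<open>(1/k!) (\<Sum>\<^sub>m\<^sub>\<ge>\<^sub>1 x\<^sub>m t\<^sup>m / m!)\<^sup>k\<close>.  The argument is a whole sequence \<open>x\<close>; only its entries
  \<open>x 1, \<dots>, x (n - k + 1)\<close> matter (lemma \<open>bell_poly_cong\<close>), and \<open>x 0\<close> is never used.
\<close>

definition bell_poly :: "nat \<Rightarrow> nat \<Rightarrow> (nat \<Rightarrow> real) \<Rightarrow> real" where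
  "bell_poly n k x =
     fact n * fps_nth (fps_const (1 / fact k) * Abs_fps (\<lambda>m. if m = 0 then 0 else x m / fact m) ^ k) n"

lemma bell_poly_egf:
  "fps_const (1 / fact k) * Abs_fps (\<lambda>m. if m = 0 then 0 else x m / fact m) ^ k =
     Abs_fps (\<lambda>n. if n < k then 0 else bell_poly n k x / fact n)"
  by (rule fps_ext) (auto simp: bell_poly_def startsby_zero_power_prefix)

lemma bell_poly_cong:
  assumes "k \<le> n" and "\<And>m. 1 \<le> m \<Longrightarrow> m \<le> n - k + 1 \<Longrightarrow> x m = y m"
  shows "bell_poly n k x = bell_poly n k y"
proof -
  define S where "S z = Abs_fps (\<lambda>m. z (Suc m) / fact (Suc m))" for z :: "nat \<Rightarrow> real"
  have eq: "Abs_fps (\<lambda>m. if m = 0 then 0 else z m / fact m) = fps_X * S z" (is "?L = ?R") for z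
  proof (rule fps_ext)
    fix n show "?L $ n = ?R $ n" by (cases n) (simp_all add: S_def del: fact_Suc)
  qed
  have pow: "\<forall>i\<le>n - k. (S x ^ j) $ i = (S y ^ j) $ i" for j
  proof (induction j)
    case (Suc j)
    have "S x $ i = S y $ i" if "i \<le> n - k" for i
      using that assms(2)[of "Suc i"] by (simp add: S_def)
    with Suc show ?case
      by (auto simp: fps_mult_nth intro!: sum.cong arg_cong2[where f = "(*)"])
  qed simp
  show ?thesis using pow assms(1)
    by (simp add: bell_poly_def eq power_mult_distrib fps_X_power_mult_nth)
qed

section \<open>Probabilistic central factorial numbers and Bell polynomials\<close>

text \<open>
  The generating function identity defining \<open>T\<^sup>Y(n, k)\<close> is one of functions of a real variable \<open>t\<close>
  near \<open>0\<close>.  The power series \<open>F\<close> in question exists, is unique, and has no terms of order below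
  \<open>k\<close> whenever the moment generating function of \<open>Y\<close> is finite around \<open>0\<close> (see
  \<open>central_T_egf\<close> below).
\<close>

definition central_T_gf :: "'a measure \<Rightarrow> ('a \<Rightarrow> real) \<Rightarrow> nat \<Rightarrow> real \<Rightarrow> real" where
  "central_T_gf M Y k t =
     1 / fact k * ((\<integral>w. exp (Y w / 2 * t) \<partial>M) - (\<integral>w. exp (- (Y w / 2) * t) \<partial>M)) ^ k"

definition central_T :: "'a measure \<Rightarrow> ('a \<Rightarrow> real) \<Rightarrow> nat \<Rightarrow> nat \<Rightarrow> real" where
  "central_T M Y n k = fact n * fps_nth (THE F. central_T_gf M Y k has_fps_expansion F) n"

definition central_bell :: "'a measure \<Rightarrow> ('a \<Rightarrow> real) \<Rightarrow> nat \<Rightarrow> real \<Rightarrow> real" where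
  "central_bell M Y n x = (\<Sum>k=0..n. central_T M Y n k * x ^ k)"

lemma has_fps_expansion_unique_real:
  fixes f :: "real \<Rightarrow> real"
  assumes "f has_fps_expansion F" "f has_fps_expansion G"
  shows "F = G"
proof -
  have zero: "H $ n = 0" if "h has_fps_expansion H" "\<forall>\<^sub>F t in nhds 0. h t = 0" for h :: "real \<Rightarrow> real" and H n
    using that
  proof (induction n arbitrary: h H)
    case 0
    then have "eval_fps H 0 = h 0" "h 0 = 0"
      by (auto simp: has_fps_expansion_def dest: eventually_nhds_x_imp_x)
    then show ?case by (simp add: eval_fps_at_0)
  next
    case (Suc n)
    have "\<forall>\<^sub>F t in nhds 0. \<forall>\<^sub>F s in nhds t. h s = 0"
      using Suc.prems(2) by (simp add: eventually_eventually)
    then have "\<forall>\<^sub>F t in nhds 0. deriv h t = 0"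
    proof eventually_elim
      case (elim t)
      then have "deriv h t = deriv (\<lambda>_. 0) t" by (intro deriv_cong_ev) auto
      then show ?case by simp
    qed
    with Suc.IH[OF has_fps_expansion_deriv[OF Suc.prems(1)]] show ?case by simp
  qed
  have "(F - G) $ n = 0" for n
    using has_fps_expansion_diff[OF assms] by (rule zero) simp
  then show ?thesis by (simp add: fps_eq_iff)
qed

lemma mgf_sums:
  fixes Y :: "'a \<Rightarrow> real"
  assumes Y: "Y \<in> borel_measurable M"
    and mgf: "\<And>t. \<bar>t\<bar> < r \<Longrightarrow> integrable M (\<lambda>w. exp (t * Y w))" and t: "\<bar>t\<bar> < r"
  shows "(\<lambda>n. (\<integral>w. Y w ^ n \<partial>M) / fact n * t ^ n) sums (\<integral>w. exp (t * Y w) \<partial>M)"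
proof -
  let ?f = "\<lambda>n w. (t * Y w) ^ n / fact n"
  let ?E = "\<lambda>w. exp (t * Y w) + exp (- t * Y w)"
  have E: "integrable M ?E" using t by (intro Bochner_Integration.integrable_add mgf) auto
  have meas: "?f n \<in> borel_measurable M" for n using Y by measurable
  have sm: "(\<lambda>n. norm (?f n w)) sums exp \<bar>t * Y w\<bar>" for w
    using exp_converges[of "\<bar>t * Y w\<bar>"] by (simp add: power_abs abs_mult divide_inverse mult.commute)
  have bound: "(\<Sum>n<m. norm (?f n w)) \<le> ?E w" for m w
  proof -
    have "(\<Sum>n<m. norm (?f n w)) \<le> exp \<bar>t * Y w\<bar>"
      using sum_le_suminf[OF sums_summable[OF sm[of w]], of "{..<m}"]
      by (simp only: sums_unique[OF sm[of w], symmetric] finite_lessThan norm_ge_zero simp_thms)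
    also have "\<dots> \<le> ?E w" by (cases "t * Y w \<ge> 0") (simp_all only: abs_of_nonneg abs_of_nonpos not_le less_imp_le
        mult_minus_left, simp_all)
    finally show ?thesis .
  qed
  have int: "integrable M (?f n)" for n
  proof (rule Bochner_Integration.integrable_bound[OF E meas], rule AE_I2)
    fix w
    have "norm (?f n w) \<le> (\<Sum>i<Suc n. norm (?f i w))" by (simp add: sum_nonneg)
    also have "\<dots> \<le> ?E w" by (rule bound)
    finally show "norm (?f n w) \<le> norm (?E w)" by simp
  qed
  have "summable (\<lambda>n. \<integral>w. norm (?f n w) \<partial>M)"
  proof (rule summableI_nonneg_bounded)
    fix m
    have "(\<Sum>n<m. \<integral>w. norm (?f n w) \<partial>M) = (\<integral>w. (\<Sum>n<m. norm (?f n w)) \<partial>M)"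
      using int by (intro Bochner_Integration.integral_sum[symmetric] integrable_norm)
    also have "\<dots> \<le> (\<integral>w. ?E w \<partial>M)"
      using int by (intro integral_mono E Bochner_Integration.integrable_sum integrable_norm bound)
    finally show "(\<Sum>n<m. \<integral>w. norm (?f n w) \<partial>M) \<le> (\<integral>w. ?E w \<partial>M)" .
  qed simp
  then have "(\<lambda>n. \<integral>w. ?f n w \<partial>M) sums (\<integral>w. (\<Sum>n. ?f n w) \<partial>M)"
    using int sm by (intro sums_integral) (auto simp: sums_iff)
  moreover have "(\<Sum>n. ?f n w) = exp (t * Y w)" for w
    using exp_converges[of "t * Y w"] by (simp add: sums_iff divide_inverse mult.commute)
  moreover have "(\<integral>w. ?f n w \<partial>M) = (\<integral>w. Y w ^ n \<partial>M) / fact n * t ^ n" for n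
    by (simp add: power_mult_distrib)
  ultimately show ?thesis by simp
qed

lemma has_fps_expansion_realI:
  fixes f :: "real \<Rightarrow> real"
  assumes "0 < r" and "\<And>t. \<bar>t\<bar> < r \<Longrightarrow> (\<lambda>n. a n * t ^ n) sums f t"
  shows "f has_fps_expansion Abs_fps a"
  unfolding has_fps_expansion_def
proof
  have "summable (\<lambda>n. a n * (r / 2) ^ n)"
    using assms(1) by (intro sums_summable[OF assms(2)]) simp
  then have "ereal (norm (r / 2)) \<le> conv_radius a"
    by (rule conv_radius_geI)
  moreover have "0 < ereal (norm (r / 2))" using assms(1) by simp
  ultimately have "0 < conv_radius a" by (rule less_le_trans[rotated])
  then show "0 < fps_conv_radius (Abs_fps a)" by (simp add: fps_conv_radius_def)
  have "\<forall>\<^sub>F t in nhds 0. t \<in> {- r<..<r}"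
    using assms(1) by (intro eventually_nhds_in_open) auto
  then show "\<forall>\<^sub>F t in nhds 0. eval_fps (Abs_fps a) t = f t"
    proof eventually_elim
    case (elim t)
    then have "(\<lambda>n. a n * t ^ n) sums f t" by (intro assms(2)) (simp add: abs_less_iff)
    then show ?case by (simp add: eval_fps_def sums_unique[symmetric])
  qed
qed

lemma central_T_egf:
  fixes Y :: "'a \<Rightarrow> real"
  assumes "prob_space M" and Y: "Y \<in> borel_measurable M" and r: "0 < r"
    and mgf: "\<And>t. \<bar>t\<bar> < r \<Longrightarrow> integrable M (\<lambda>w. exp (t * Y w))"
  shows "central_T_gf M Y k has_fps_expansion
           Abs_fps (\<lambda>n. if n < k then 0 else central_T M Y n k / fact n)"
proof -
  define a where "a n = (\<integral>w. Y w ^ n \<partial>M) / fact n * ((1 / 2) ^ n - (- 1 / 2) ^ n)" for n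
  define d where "d t = (\<integral>w. exp (Y w / 2 * t) \<partial>M) - (\<integral>w. exp (- (Y w / 2) * t) \<partial>M)" for t
  have "(\<lambda>n. a n * t ^ n) sums d t" if "\<bar>t\<bar> < r" for t
  proof -
    let ?b = "\<lambda>n. (\<integral>w. Y w ^ n \<partial>M) / fact n"
    have "(\<lambda>n. ?b n * (t / 2) ^ n - ?b n * (- t / 2) ^ n) sums
        ((\<integral>w. exp (t / 2 * Y w) \<partial>M) - (\<integral>w. exp (- t / 2 * Y w) \<partial>M))"
      using that by (intro sums_diff mgf_sums[OF Y mgf]) auto
    moreover have "?b n * (t / 2) ^ n - ?b n * (- t / 2) ^ n = a n * t ^ n" for n
    proof -
      have "(t / 2) ^ n = (1 / 2) ^ n * t ^ n" "(- t / 2) ^ n = (- 1 / 2) ^ n * t ^ n"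
        by (simp_all flip: power_mult_distrib)
      then show ?thesis unfolding a_def by (simp only: algebra_simps)
    qed
    ultimately show ?thesis by (simp add: d_def mult.commute)
  qed
  from has_fps_expansion_realI[OF r this] have "d has_fps_expansion Abs_fps a" .
  then have "(\<lambda>t. \<Prod>i<k. d t) has_fps_expansion (\<Prod>i<k. Abs_fps a)"
    by (intro has_fps_expansion_prod)
  then have "(\<lambda>t. 1 / fact k * d t ^ k) has_fps_expansion fps_const (1 / fact k) * Abs_fps a ^ k"
    by (intro has_fps_expansion_cmult_left) simp
  moreover have "central_T_gf M Y k = (\<lambda>t. 1 / fact k * d t ^ k)"
    by (simp add: fun_eq_iff central_T_gf_def d_def)
  ultimately have F: "central_T_gf M Y k has_fps_expansion fps_const (1 / fact k) * Abs_fps a ^ k"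
    (is "_ has_fps_expansion ?F") by simp
  then have "(THE F. central_T_gf M Y k has_fps_expansion F) = ?F"
    by (intro the_equality) (auto intro: has_fps_expansion_unique_real)
  moreover have "?F $ n = 0" if "n < k" for n
    using that by (simp add: startsby_zero_power_prefix a_def)
  ultimately have "Abs_fps (\<lambda>n. if n < k then 0 else central_T M Y n k / fact n) = ?F"
    by (intro fps_ext) (simp add: central_T_def)
  with F show ?thesis by simp
qed

end

(* Writing D(t) = E[exp(tY/2)] - E[exp(-tY/2)], the polynomials B_n(x) have the exponential
   generating function exp(x D(t)).  The arguments m B_{m-1}(x) of the Bell polynomial have the
   generating function t exp(x D(t)), whose k-th power is t^k exp(k x D(t)); comparing
   coefficients of t^n gives the identity. *)

theory Submission
  imports Defs
begin

text \<open>The generating function for \<open>k\<close> is the \<open>k\<close>-th power of the one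
  for \<open>1\<close>, divided by \<open>k!\<close>. Uniqueness of expansions turns this into an
  identity of formal series, so everything after it is free of analysis.\<close>

lemma central_T_eq_fps_power:
  fixes Y :: "'a \<Rightarrow> real"
  assumes "prob_space M" "Y \<in> borel_measurable M" "0 < r"
    and "\<And>t. \<bar>t\<bar> < r \<Longrightarrow> integrable M (\<lambda>w. exp (t * Y w))"
  obtains D where "D $ 0 = 0" "\<And>n k. central_T M Y n k = fact n / fact k * (D ^ k) $ n"
proof
  let ?D = "Abs_fps (\<lambda>n. if n < 1 then 0 else central_T M Y n 1 / fact n)"
  show "?D $ 0 = 0" by simp
  fix n k
  have "central_T_gf M Y 1 has_fps_expansion ?D"
    using assms by (rule central_T_egf)
  then have "(\<lambda>t. 1 / fact k * (\<Prod>i<k. central_T_gf M Y 1 t)) has_fps_expansion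
      fps_const (1 / fact k) * (\<Prod>i<k. ?D)"
    by (intro has_fps_expansion_cmult_left has_fps_expansion_prod)
  moreover have "(\<lambda>t. 1 / fact k * (\<Prod>i<k. central_T_gf M Y 1 t)) = central_T_gf M Y k"
    by (simp add: fun_eq_iff central_T_gf_def)
  ultimately have "central_T_gf M Y k has_fps_expansion fps_const (1 / fact k) * ?D ^ k"
    by simp
  then have "(THE F. central_T_gf M Y k has_fps_expansion F) = fps_const (1 / fact k) * ?D ^ k"
    by (intro the_equality) (auto intro: has_fps_expansion_unique_real)
  then show "central_T M Y n k = fact n / fact k * (?D ^ k) $ n"
    by (simp add: central_T_def)
qed

theorem theorem2p11:
  fixes M :: "'a measure" and Y :: "'a \<Rightarrow> real" and r x :: real and n k :: nat
  assumes "prob_space M"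
    and "Y \<in> borel_measurable M"
    and "0 < r"
    and "\<And>t. \<bar>t\<bar> < r \<Longrightarrow> integrable M (\<lambda>w. exp (t * Y w))"
    and "k \<le> n"
  shows "(\<Sum>j=0..n - k. real (n choose k) * real k ^ j * x ^ j * central_T M Y (n - k) j) =
         bell_poly n k (\<lambda>m. real m * central_bell M Y (m - 1) x)"
proof -
  obtain D where D: "D $ 0 = 0" "\<And>n k. central_T M Y n k = fact n / fact k * (D ^ k) $ n"
    using central_T_eq_fps_power[OF assms(1-4)] by blast
  \<comment> \<open>Kept general in \<open>y\<close>: it is used at \<open>x\<close> for the
    arguments of the Bell polynomial and at \<open>k * x\<close> for the other side.\<close>
  have bell_egf: "central_bell M Y m y = fact m * (fps_exp y oo D) $ m" for m y
    by (simp add: central_bell_def D(2) fps_compose_nth sum_distrib_left field_simps)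
  have "Abs_fps (\<lambda>m. if m = 0 then 0 else real m * central_bell M Y (m - Suc 0) x / fact m) =
      fps_X * (fps_exp x oo D)" (is "?L = ?R")
  proof (rule fps_ext)
    \<comment> \<open>For \<open>m > 0\<close>, \<open>m / m! = 1 / (m - 1)!\<close>, which is the
      index shift made by \<open>fps_X\<close>.\<close>
    fix m show "?L $ m = ?R $ m" by (cases m) (simp_all add: bell_egf)
  qed
  \<comment> \<open>Powers pass through the composition because \<open>D\<close> has zero constant
    term.\<close>
  moreover have "(fps_exp x oo D) ^ k = fps_exp (k * x) oo D"
    using fps_compose_power[OF D(1)] by (simp add: fps_exp_power_mult)
  ultimately have "bell_poly n k (\<lambda>m. real m * central_bell M Y (m - 1) x) =
      fact n / fact k * (fps_exp (k * x) oo D) $ (n - k)"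
    using assms(5) by (simp add: bell_poly_def power_mult_distrib fps_X_power_mult_nth)
  \<comment> \<open>Reading off coefficient \<open>n - k\<close> leaves a factor
    \<open>1 / (n - k)!\<close>, which completes the binomial coefficient.\<close>
  also have "\<dots> = real (n choose k) * central_bell M Y (n - k) (k * x)"
    using assms(5) by (simp add: bell_egf binomial_fact)
  also have "\<dots> = (\<Sum>j=0..n - k. real (n choose k) * real k ^ j * x ^ j * central_T M Y (n - k) j)"
    by (simp add: central_bell_def sum_distrib_left power_mult_distrib mult_ac)
  finally show ?thesis ..
qed

end
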